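(* Let $(\Omega,S)$ be a Frobenius scheme of valency $k$ and rank at least $4(k-1)k^3$. Then $(\Omega,S)$ is determined up to isomorphism by its intersection numbers: every scheme $(\Omega',S')$ algebraically isomorphic to $(\Omega,S)$ is isomorphic to $(\Omega,S)$ (indeed every algebraic isomorphism $\varphi:S\to S'$ is induced by an isomorphism).
   Context: A coherent configuration is a pair $(\Omega,S)$ with $\Omega$ finite and $S$ a partition of $\Omega\times\Omega$ such that the diagonal $1_\Omega$ is a union of elements of $S$, $S$ is closed under transposition, and for $r,s,t\in S$ the number $c_{rs}^t=|\{\beta:(\alpha,\beta)\in r,(\beta,\gamma)\in s\}|$ does not depend on $(\alpha,\gamma)\in t$ (intersection numbers). A scheme is one with $1_\Omega\in S$; rank $|S|$; valency $n_s=|\{\beta:(\alpha,\beta)\in s\}|$. A Frobenius group is a non-regular transitive permutation group $G\le\mathrm{Sym}(\Omega)$ in which only the identity fixes two distinct points; a Frobenius scheme is the scheme of a Frobenius group, i.e. $S$ is the set of orbits of $G$ on $\Omega\times\Omega$; all its basis relations other than $1_\Omega$ have the same valency $k$ (equal to the order of a point stabilizer), called the valency of the scheme. An algebraic isomorphism $\varphi:S\to S'$ is a bijection with $c_{\varphi(r)\varphi(s)}^{\varphi(t)}=c_{rs}^t$ for all $r,s,t$; an isomorphism is a bijection $f:\Omega\to\Omega'$ mapping each element of $S$ onto an element of $S'$; it induces $\varphi$ if $f(s)=\varphi(s)$ for all $s\in S$. *)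

theory Defs
  imports Main
begin

definition partition_of :: "'a set \<Rightarrow> ('a \<times> 'a) set set \<Rightarrow> bool" where
  "partition_of \<Omega> S \<longleftrightarrow>
     (\<forall>s\<in>S. s \<noteq> {}) \<and>
     (\<forall>r\<in>S. \<forall>s\<in>S. r \<noteq> s \<longrightarrow> r \<inter> s = {}) \<and>
     \<Union>S = \<Omega> \<times> \<Omega>"

definition path_count :: "('a \<times> 'a) set \<Rightarrow> ('a \<times> 'a) set \<Rightarrow> 'a \<Rightarrow> 'a \<Rightarrow> nat" where
  "path_count r s \<alpha> \<gamma> = card {\<beta>. (\<alpha>, \<beta>) \<in> r \<and> (\<beta>, \<gamma>) \<in> s}"

definition coherent_configuration :: "'a set \<Rightarrow> ('a \<times> 'a) set set \<Rightarrow> bool" where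
  "coherent_configuration \<Omega> S \<longleftrightarrow>
     finite \<Omega> \<and> partition_of \<Omega> S \<and>
     (\<exists>T\<subseteq>S. \<Union>T = Id_on \<Omega>) \<and>
     (\<forall>s\<in>S. s\<inverse> \<in> S) \<and>
     (\<forall>r\<in>S. \<forall>s\<in>S. \<forall>t\<in>S. \<forall>x\<in>t. \<forall>y\<in>t.
        path_count r s (fst x) (snd x) = path_count r s (fst y) (snd y))"

definition scheme :: "'a set \<Rightarrow> ('a \<times> 'a) set set \<Rightarrow> bool" where
  "scheme \<Omega> S \<longleftrightarrow> coherent_configuration \<Omega> S \<and> Id_on \<Omega> \<in> S"

text \<open>Intersection number c_{rs}^t (well defined for a coherent configuration).\<close>
definition int_num :: "('a \<times> 'a) set \<Rightarrow> ('a \<times> 'a) set \<Rightarrow> ('a \<times> 'a) set \<Rightarrow> nat" where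
  "int_num r s t = (let x = (SOME x. x \<in> t) in path_count r s (fst x) (snd x))"

definition valency :: "('a \<times> 'a) set \<Rightarrow> 'a \<Rightarrow> nat" where
  "valency s \<alpha> = card {\<beta>. (\<alpha>, \<beta>) \<in> s}"

definition algebraic_isomorphism ::
  "('a \<times> 'a) set set \<Rightarrow> ('b \<times> 'b) set set \<Rightarrow> (('a \<times> 'a) set \<Rightarrow> ('b \<times> 'b) set) \<Rightarrow> bool" where
  "algebraic_isomorphism S S' \<phi> \<longleftrightarrow>
     bij_betw \<phi> S S' \<and>
     (\<forall>r\<in>S. \<forall>s\<in>S. \<forall>t\<in>S. int_num (\<phi> r) (\<phi> s) (\<phi> t) = int_num r s t)"

definition pair_image :: "('a \<Rightarrow> 'b) \<Rightarrow> ('a \<times> 'a) set \<Rightarrow> ('b \<times> 'b) set" where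
  "pair_image f s = (\<lambda>(x, y). (f x, f y)) ` s"

definition isomorphism ::
  "'a set \<Rightarrow> ('a \<times> 'a) set set \<Rightarrow> 'b set \<Rightarrow> ('b \<times> 'b) set set \<Rightarrow> ('a \<Rightarrow> 'b) \<Rightarrow> bool" where
  "isomorphism \<Omega> S \<Omega>' S' f \<longleftrightarrow> bij_betw f \<Omega> \<Omega>' \<and> (\<forall>s\<in>S. pair_image f s \<in> S')"

definition induces :: "('a \<Rightarrow> 'b) \<Rightarrow> ('a \<times> 'a) set set \<Rightarrow> (('a \<times> 'a) set \<Rightarrow> ('b \<times> 'b) set) \<Rightarrow> bool" where
  "induces f S \<phi> \<longleftrightarrow> (\<forall>s\<in>S. pair_image f s = \<phi> s)"

definition perm_group_on :: "'a set \<Rightarrow> ('a \<Rightarrow> 'a) set \<Rightarrow> bool" where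
  "perm_group_on \<Omega> G \<longleftrightarrow>
     (\<forall>g\<in>G. bij_betw g \<Omega> \<Omega> \<and> (\<forall>x. x \<notin> \<Omega> \<longrightarrow> g x = x)) \<and>
     id \<in> G \<and> (\<forall>g\<in>G. \<forall>h\<in>G. g \<circ> h \<in> G) \<and>
     (\<forall>g\<in>G. \<exists>h\<in>G. h \<circ> g = id)"

definition transitive_on :: "'a set \<Rightarrow> ('a \<Rightarrow> 'a) set \<Rightarrow> bool" where
  "transitive_on \<Omega> G \<longleftrightarrow> (\<forall>x\<in>\<Omega>. \<forall>y\<in>\<Omega>. \<exists>g\<in>G. g x = y)"

definition regular_on :: "'a set \<Rightarrow> ('a \<Rightarrow> 'a) set \<Rightarrow> bool" where
  "regular_on \<Omega> G \<longleftrightarrow> transitive_on \<Omega> G \<and> (\<forall>g\<in>G. \<forall>x\<in>\<Omega>. g x = x \<longrightarrow> g = id)"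

definition frobenius_group :: "'a set \<Rightarrow> ('a \<Rightarrow> 'a) set \<Rightarrow> bool" where
  "frobenius_group \<Omega> G \<longleftrightarrow>
     finite \<Omega> \<and> perm_group_on \<Omega> G \<and> transitive_on \<Omega> G \<and> \<not> regular_on \<Omega> G \<and>
     (\<forall>g\<in>G. \<forall>x\<in>\<Omega>. \<forall>y\<in>\<Omega>. x \<noteq> y \<and> g x = x \<and> g y = y \<longrightarrow> g = id)"

definition orbits2 :: "'a set \<Rightarrow> ('a \<Rightarrow> 'a) set \<Rightarrow> ('a \<times> 'a) set set" where
  "orbits2 \<Omega> G = (\<lambda>(x, y). {(g x, g y) | g. g \<in> G}) ` (\<Omega> \<times> \<Omega>)"

definition frobenius_scheme :: "'a set \<Rightarrow> ('a \<times> 'a) set set \<Rightarrow> bool" where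
  "frobenius_scheme \<Omega> S \<longleftrightarrow> (\<exists>G. frobenius_group \<Omega> G \<and> S = orbits2 \<Omega> G)"

definition scheme_valency_is :: "'a set \<Rightarrow> ('a \<times> 'a) set set \<Rightarrow> nat \<Rightarrow> bool" where
  "scheme_valency_is \<Omega> S k \<longleftrightarrow> (\<forall>s\<in>S. s \<noteq> Id_on \<Omega> \<longrightarrow> (\<forall>\<alpha>\<in>\<Omega>. valency s \<alpha> = k))"

end

theory Submission
  imports Defs
begin

text \<open>
  Say that a pair of points of \<open>\<Omega>\<close> matches a pair of points of \<open>\<Omega>'\<close> if \<open>\<phi>\<close> maps the relation of
  the first pair to the relation of the second. Intersection numbers allow a matching pair to be
  extended by any third point. Moreover, if \<open>a, b, c, e\<close> are such that the complex products
  \<open>r(c,a) r(a,e)\<close> and \<open>r(c,b) r(b,e)\<close> have only \<open>r(c,e)\<close> in common, then in any lift of these four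
  points to \<open>\<Omega>'\<close> for which all pairs except \<open>ab\<close> and \<open>ce\<close> match, \<open>ce\<close> matches too. In a Frobenius
  group two distinct elements agree in at most one point, so this rigidity fails only for \<open>O(k\<^sup>3)\<close>
  choices of the last point once the others are generic.

  Starting from one matching pair, lift every point to \<open>\<Omega>'\<close>; by rigidity almost all pairs of lifted
  points match. Correct the lift of each point so that it matches almost all other lifts. Any two
  corrected points then match, by rigidity relative to a suitable pair \<open>a, b\<close>, which exists because
  \<open>|\<Omega>|\<close> is large compared with \<open>k\<^sup>3\<close>.
\<close>

section \<open>Frobenius groups\<close>

locale frobenius =
  fixes \<Omega> :: "'a set" and G :: "('a \<Rightarrow> 'a) set"
  assumes frobenius_group: "frobenius_group \<Omega> G"
begin

definition stab :: "'a \<Rightarrow> ('a \<Rightarrow> 'a) set" where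
  "stab a = {g \<in> G. g a = a}"

definition orbital :: "'a \<Rightarrow> 'a \<Rightarrow> ('a \<times> 'a) set" where
  "orbital x y = {(g x, g y) | g. g \<in> G}"

text \<open>The condition making \<open>independent4 a b c\<close> hold for all but few points: no non-trivial
  \<open>g \<in> stab a\<close> agrees with some \<open>x \<circ> h\<close> everywhere.\<close>

definition independent3 :: "'a \<Rightarrow> 'a \<Rightarrow> 'a \<Rightarrow> bool" where
  "independent3 a b c \<longleftrightarrow> (\<forall>g\<in>stab a - {id}. \<forall>x\<in>stab c. \<forall>h\<in>stab b. g \<noteq> x \<circ> h)"

text \<open>This forces \<open>orbital c (g e) = orbital c (h e)\<close> with \<open>g \<in> stab a\<close>, \<open>h \<in> stab b\<close> only for
  \<open>g = id\<close>, i.e. the two complex products from \<open>c\<close> to \<open>e\<close> meet in a single relation.\<close>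

definition independent4 :: "'a \<Rightarrow> 'a \<Rightarrow> 'a \<Rightarrow> 'a \<Rightarrow> bool" where
  "independent4 a b c e \<longleftrightarrow> (\<forall>g\<in>stab a - {id}. \<forall>x\<in>stab c. \<forall>h\<in>stab b. g e \<noteq> x (h e))"

section \<open>Elementary facts on Frobenius groups\<close>

lemma finite_points: "finite \<Omega>"
  using frobenius_group by (simp add: frobenius_group_def)

lemma id_in: "id \<in> G"
  using frobenius_group by (simp add: frobenius_group_def perm_group_on_def)

lemma comp_in: "g \<in> G \<Longrightarrow> h \<in> G \<Longrightarrow> g \<circ> h \<in> G"
  using frobenius_group by (simp add: frobenius_group_def perm_group_on_def)

lemma bij_betw_points: "g \<in> G \<Longrightarrow> bij_betw g \<Omega> \<Omega>"
  using frobenius_group by (simp add: frobenius_group_def perm_group_on_def)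

lemma fixes_outside: "g \<in> G \<Longrightarrow> x \<notin> \<Omega> \<Longrightarrow> g x = x"
  using frobenius_group by (simp add: frobenius_group_def perm_group_on_def)

lemma maps_points: "g \<in> G \<Longrightarrow> x \<in> \<Omega> \<Longrightarrow> g x \<in> \<Omega>"
  using bij_betw_points bij_betwE by blast

lemma left_inverse: "g \<in> G \<Longrightarrow> \<exists>h\<in>G. h \<circ> g = id"
  using frobenius_group by (simp add: frobenius_group_def perm_group_on_def)

lemma bij: assumes "g \<in> G" shows "bij g"
proof -
  obtain h where h: "h \<in> G" "h \<circ> g = id" using left_inverse[OF assms] by auto
  obtain h' where h': "h' \<in> G" "h' \<circ> h = id" using left_inverse[OF h(1)] by auto
  \<comment> \<open>Cancelling in \<open>h' \<circ> h \<circ> g\<close> turns the left inverse into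
    a two-sided one.\<close>
  have "h' = g" using h(2) h'(2) by (metis comp_assoc comp_id id_comp)
  then show ?thesis using h h' by (metis o_bij)
qed

lemma inv_in: assumes "g \<in> G" shows "inv g \<in> G"
proof -
  obtain h where "h \<in> G" "h \<circ> g = id" using left_inverse[OF assms] by auto
  moreover have "h = inv g" using bij[OF assms] \<open>h \<circ> g = id\<close>
    by (metis bij_is_surj comp_assoc comp_id id_comp surj_iff)
  ultimately show ?thesis by simp
qed

lemma inv_apply: "g \<in> G \<Longrightarrow> inv g (g x) = x" "g \<in> G \<Longrightarrow> g (inv g x) = x"
  using bij by (simp_all add: bij_is_inj bij_is_surj surj_f_inv_f)

lemma two_fixed_points:
  "g \<in> G \<Longrightarrow> x \<in> \<Omega> \<Longrightarrow> y \<in> \<Omega> \<Longrightarrow> x \<noteq> y \<Longrightarrow> g x = x \<Longrightarrow> g y = y \<Longrightarrow> g = id"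
  using frobenius_group unfolding frobenius_group_def by blast

lemma agree_at_two_points:
  assumes "g \<in> G" "h \<in> G" "x \<in> \<Omega>" "y \<in> \<Omega>" "x \<noteq> y" "g x = h x" "g y = h y"
  shows "g = h"
proof -
  have "inv h \<circ> g = id"
    using assms by (intro two_fixed_points[of _ x y]) (simp_all add: comp_in inv_in inv_apply)
  then show ?thesis using inv_apply(2)[OF assms(2)] by (metis comp_apply id_apply ext)
qed

lemma stab_in: "g \<in> stab a \<Longrightarrow> g \<in> G" and stab_fixes: "g \<in> stab a \<Longrightarrow> g a = a"
  by (simp_all add: stab_def)

lemma stab_inv: "g \<in> stab a \<Longrightarrow> inv g \<in> stab a"
  using inv_in inv_apply(1) unfolding stab_def by (metis (mono_tags, lifting) mem_Collect_eq)

lemma stab_inter: "a \<in> \<Omega> \<Longrightarrow> b \<in> \<Omega> \<Longrightarrow> a \<noteq> b \<Longrightarrow> g \<in> stab a \<Longrightarrow> g \<in> stab b \<Longrightarrow> g = id"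
  using two_fixed_points[of g a b] by (simp add: stab_def)

section \<open>Orbitals, the basis relations of the scheme\<close>

lemma orbitalI: "g \<in> G \<Longrightarrow> (g x, g y) \<in> orbital x y"
  unfolding orbital_def by blast

lemma orbital_refl: "(x, y) \<in> orbital x y"
  using orbitalI[OF id_in, of x y] by simp

lemma orbital_image: "g \<in> G \<Longrightarrow> orbital (g x) (g y) = orbital x y"
proof -
  assume g: "g \<in> G"
  have "(h (g x), h (g y)) \<in> orbital x y" if "h \<in> G" for h
    using orbitalI[OF comp_in[OF that g]] by simp
  moreover have "(h x, h y) \<in> orbital (g x) (g y)" if "h \<in> G" for h
    using orbitalI[OF comp_in[OF that inv_in[OF g]], of "g x" "g y"] inv_apply(1)[OF g] by simp
  ultimately show ?thesis unfolding orbital_def by blast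
qed

lemma orbital_eq: "(u, v) \<in> orbital x y \<Longrightarrow> orbital u v = orbital x y"
  using orbital_image unfolding orbital_def by blast

lemma orbital_in: "x \<in> \<Omega> \<Longrightarrow> y \<in> \<Omega> \<Longrightarrow> orbital x y \<in> orbits2 \<Omega> G"
  unfolding orbits2_def orbital_def by force

lemma orbits2_eq_orbital: "r \<in> orbits2 \<Omega> G \<Longrightarrow> (x, y) \<in> r \<Longrightarrow> r = orbital x y"
  using orbital_eq unfolding orbits2_def by (auto simp: orbital_def[symmetric])

lemma orbital_stab:
  assumes "(a, y) \<in> orbital a e" obtains g where "g \<in> stab a" "y = g e"
proof -
  obtain g where "g \<in> G" "a = g a" "y = g e" using assms unfolding orbital_def by blast
  then show ?thesis using that[of g] by (simp add: stab_def)
qed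

lemma orbital_same_source:
  assumes "orbital c y = orbital c z" obtains x where "x \<in> stab c" "y = x z"
  using assms orbital_refl[of c y] orbital_stab by metis

text \<open>Two distinct elements of \<open>G\<close> agree in at most one point, so each index
  \<open>t\<close> accounts for at most one coincidence. Choosing an index for every such point is
  therefore injective.\<close>

lemma card_coincidences:
  assumes "finite T" and "\<And>t. t \<in> T \<Longrightarrow> A t \<in> G \<and> B t \<in> G \<and> A t \<noteq> B t"
  shows "card {p \<in> \<Omega>. \<exists>t\<in>T. A t p = B t p} \<le> card T"
proof -
  define h where "h p = (SOME t. t \<in> T \<and> A t p = B t p)" for p
  let ?P = "{p \<in> \<Omega>. \<exists>t\<in>T. A t p = B t p}"
  have h: "h p \<in> T" "A (h p) p = B (h p) p" if "p \<in> ?P" for p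
    using someI_ex[of "\<lambda>t. t \<in> T \<and> A t p = B t p"] that unfolding h_def by blast+
  have "inj_on h ?P"
  proof (rule inj_onI, rule ccontr)
    fix p q assume pq: "p \<in> ?P" "q \<in> ?P" "h p = h q" "p \<noteq> q"
    then show False
      using agree_at_two_points[of "A (h p)" "B (h p)" p q] assms(2)[of "h p"] h(1,2)[of p]
        h(2)[of q] by auto
  qed
  then show ?thesis using h(1) assms(1) by (intro card_inj_on_le[of h]) auto
qed

lemma finite_stab:
  assumes "a \<in> \<Omega>" "b \<in> \<Omega>" "a \<noteq> b" shows "finite (stab a)"
proof -
  have "inj_on (\<lambda>g. g b) (stab a)"
    by (rule inj_onI) (use assms agree_at_two_points[of _ _ a b] in \<open>auto simp: stab_def\<close>)
  moreover have "(\<lambda>g. g b) ` stab a \<subseteq> \<Omega>"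
    using maps_points assms(2) by (auto simp: stab_def)
  ultimately show ?thesis using finite_points inj_on_finite by blast
qed

lemma valency_orbital:
  assumes "a \<in> \<Omega>" "b \<in> \<Omega>" "a \<noteq> b" shows "valency (orbital a b) a = card (stab a)"
proof -
  have "inj_on (\<lambda>g. g b) (stab a)"
    by (rule inj_onI) (use assms agree_at_two_points[of _ _ a b] in \<open>auto simp: stab_def\<close>)
  moreover have "(\<lambda>g. g b) ` stab a = {\<beta>. (a, \<beta>) \<in> orbital a b}"
    by (auto simp: stab_def orbital_def) metis
  ultimately show ?thesis unfolding valency_def by (metis card_image)
qed

end

section \<open>Counting points in special position\<close>

locale frobenius_valency = frobenius +
  fixes k :: nat
  assumes card_stab: "a \<in> \<Omega> \<Longrightarrow> card (stab a) = k" and k_ge_2: "k \<ge> 2"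
begin

text \<open>Every exceptional set of points that has to be avoided has at most this size.\<close>

definition exc :: nat where "exc = (k - 1) * k ^ 2"

lemma fin_stab: "a \<in> \<Omega> \<Longrightarrow> finite (stab a)"
  using card_stab k_ge_2 card.infinite by fastforce

lemma card_stab_minus: "a \<in> \<Omega> \<Longrightarrow> card (stab a - {id}) = k - 1"
  using card_stab by (subst card_Diff_singleton) (auto simp: stab_def id_in)

lemma square_le_exc: "k * k \<le> exc"
  unfolding exc_def power2_eq_square using k_ge_2 by (simp add: Suc_le_eq)

lemma exc_ge_1: "1 \<le> exc"
  unfolding exc_def using k_ge_2 by (simp add: Suc_le_eq)

text \<open>Allowing a subset \<open>T\<close> lets pairs with \<open>A t = B t\<close> be
  discarded. The natural bound \<open>k * k\<close> is relaxed to \<open>exc\<close> so that all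
  exceptional sets share one bound.\<close>

lemma card_coincidences_stab2:
  assumes "a \<in> \<Omega>" "b \<in> \<Omega>" "T \<subseteq> stab a \<times> stab b"
    and "\<And>t. t \<in> T \<Longrightarrow> A t \<in> G \<and> B t \<in> G \<and> A t \<noteq> B t"
    and "P \<subseteq> {p \<in> \<Omega>. \<exists>t\<in>T. A t p = B t p}"
  shows "card P \<le> exc"
proof -
  have fin: "finite (stab a \<times> stab b)" using fin_stab assms(1,2) by simp
  have "card P \<le> card {p \<in> \<Omega>. \<exists>t\<in>T. A t p = B t p}"
    using assms(5) finite_points by (intro card_mono) auto
  also have "\<dots> \<le> card T"
    by (rule card_coincidences[OF finite_subset[OF assms(3) fin] assms(4)])
  also have "\<dots> \<le> card (stab a \<times> stab b)" by (rule card_mono[OF fin assms(3)])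
  also have "\<dots> = k * k" using card_stab assms(1,2) by (simp add: card_cartesian_product)
  finally show ?thesis using square_le_exc by linarith
qed

lemma card_coincidences_stab3:
  assumes "a \<in> \<Omega>" "b \<in> \<Omega>" "c \<in> \<Omega>"
    and "\<And>t. t \<in> (stab a - {id}) \<times> stab b \<times> stab c \<Longrightarrow> A t \<in> G \<and> B t \<in> G \<and> A t \<noteq> B t"
    and "P \<subseteq> {p \<in> \<Omega>. \<exists>t\<in>(stab a - {id}) \<times> stab b \<times> stab c. A t p = B t p}"
  shows "card P \<le> exc"
proof -
  let ?T = "(stab a - {id}) \<times> stab b \<times> stab c"
  have fin: "finite ?T" using fin_stab assms(1-3) by simp
  have "card P \<le> card {p \<in> \<Omega>. \<exists>t\<in>?T. A t p = B t p}"
    using assms(5) finite_points by (intro card_mono) auto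
  also have "\<dots> \<le> card ?T" by (rule card_coincidences[OF fin assms(4)])
  also have "\<dots> = exc" using card_stab card_stab_minus assms(1-3)
    by (simp add: card_cartesian_product exc_def power2_eq_square)
  finally show ?thesis .
qed

text \<open>If \<open>g = x \<circ> h\<close> violates independence, then \<open>c\<close> is fixed
  by \<open>x = g \<circ> inv h\<close>. This is not the identity, since otherwise
  \<open>g = h\<close> would fix both \<open>a\<close> and \<open>b\<close>.\<close>

lemma card_dependent3_third:
  assumes "a \<in> \<Omega>" "b \<in> \<Omega>" "a \<noteq> b"
  shows "card {c \<in> \<Omega>. \<not> independent3 a b c} \<le> exc"
proof (rule card_coincidences_stab2[of a b "(stab a - {id}) \<times> stab b" "\<lambda>(g, h). g \<circ> h" "\<lambda>_. id"])
  fix t assume "t \<in> (stab a - {id}) \<times> stab b"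
  then obtain g h where t: "t = (g, h)" "g \<in> stab a" "g \<noteq> id" "h \<in> stab b" by auto
  have "g \<circ> h \<noteq> id"
  proof
    assume gh: "g \<circ> h = id"
    then have "g b = b" using stab_fixes[OF t(4)] by (metis comp_apply id_apply)
    then show False using t stab_inter[OF assms, of g] by (simp add: stab_def)
  qed
  then show "(case t of (g, h) \<Rightarrow> g \<circ> h) \<in> G \<and> id \<in> G \<and> (case t of (g, h) \<Rightarrow> g \<circ> h) \<noteq> id"
    using t comp_in id_in stab_in by auto
next
  show "{c \<in> \<Omega>. \<not> independent3 a b c}
    \<subseteq> {p \<in> \<Omega>. \<exists>t\<in>(stab a - {id}) \<times> stab b. (case t of (g, h) \<Rightarrow> g \<circ> h) p = id p}"
  proof
    fix c assume "c \<in> {c \<in> \<Omega>. \<not> independent3 a b c}"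
    then obtain x h where c: "c \<in> \<Omega>" "x \<circ> h \<in> stab a - {id}" "x \<in> stab c" "h \<in> stab b"
      unfolding independent3_def by blast
    have "(x \<circ> h) (inv h c) = c"
      using c inv_apply(2)[of h c] stab_in stab_fixes by simp
    then show "c \<in> {p \<in> \<Omega>. \<exists>t\<in>(stab a - {id}) \<times> stab b. (case t of (g, h) \<Rightarrow> g \<circ> h) p = id p}"
      using c stab_inv by (intro CollectI conjI bexI[of _ "(x \<circ> h, inv h)"]) auto
  qed
qed (use assms in auto)

text \<open>As \<open>h\<close> fixes \<open>b\<close>, a violation \<open>g = x \<circ> h\<close>
  makes \<open>g\<close> and \<open>x\<close> agree at \<open>b\<close>. They differ because
  stabilizers of distinct points meet trivially.\<close>

lemma card_dependent3_second:
  assumes "a \<in> \<Omega>" "c \<in> \<Omega>" "a \<noteq> c"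
  shows "card {b \<in> \<Omega>. \<not> independent3 a b c} \<le> exc"
proof (rule card_coincidences_stab2[of a c "(stab a - {id}) \<times> stab c" fst snd])
  show "{b \<in> \<Omega>. \<not> independent3 a b c}
    \<subseteq> {p \<in> \<Omega>. \<exists>t\<in>(stab a - {id}) \<times> stab c. fst t p = snd t p}"
  proof
    fix b assume "b \<in> {b \<in> \<Omega>. \<not> independent3 a b c}"
    then obtain x h where b: "b \<in> \<Omega>" "x \<circ> h \<in> stab a - {id}" "x \<in> stab c" "h \<in> stab b"
      unfolding independent3_def by blast
    then show "b \<in> {p \<in> \<Omega>. \<exists>t\<in>(stab a - {id}) \<times> stab c. fst t p = snd t p}"
      using stab_fixes[OF b(4)] by (intro CollectI conjI bexI[of _ "(x \<circ> h, x)"]) auto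
  qed
qed (use assms stab_in stab_inter[OF assms] in auto)

text \<open>A violation makes \<open>a\<close> a fixed point of a non-trivial
  \<open>x \<circ> h\<close>. The identity is filtered out of these products directly, so
  \<open>b = c\<close> is permitted, as \<open>match\<close> in \<open>induced\<close>
  requires.\<close>

lemma card_dependent3_first:
  assumes "b \<in> \<Omega>" "c \<in> \<Omega>"
  shows "card {a \<in> \<Omega>. \<not> independent3 a b c} \<le> exc"
proof (rule card_coincidences_stab2[of c b "{t \<in> stab c \<times> stab b. fst t \<circ> snd t \<noteq> id}" "\<lambda>t. fst t \<circ> snd t" "\<lambda>_. id"])
  show "{a \<in> \<Omega>. \<not> independent3 a b c}
    \<subseteq> {p \<in> \<Omega>. \<exists>t\<in>{t \<in> stab c \<times> stab b. fst t \<circ> snd t \<noteq> id}. (fst t \<circ> snd t) p = id p}"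
  proof
    fix a assume "a \<in> {a \<in> \<Omega>. \<not> independent3 a b c}"
    then obtain x h where a: "a \<in> \<Omega>" "x \<circ> h \<in> stab a - {id}" "x \<in> stab c" "h \<in> stab b"
      unfolding independent3_def by blast
    then show "a \<in> {p \<in> \<Omega>. \<exists>t\<in>{t \<in> stab c \<times> stab b. fst t \<circ> snd t \<noteq> id}. (fst t \<circ> snd t) p = id p}"
      using stab_fixes[of "x \<circ> h" a] by (intro CollectI conjI bexI[of _ "(x, h)"]) auto
  qed
qed (use assms stab_in comp_in id_in in auto)

text \<open>At a violating \<open>e\<close> the elements \<open>g\<close> and
  \<open>x \<circ> h\<close> agree, and \<open>independent3\<close> says exactly that they are
  distinct.\<close>

lemma card_dependent4_fourth:
  assumes "a \<in> \<Omega>" "b \<in> \<Omega>" "c \<in> \<Omega>" "independent3 a b c"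
  shows "card {e \<in> \<Omega>. \<not> independent4 a b c e} \<le> exc"
proof (rule card_coincidences_stab3[of a c b "\<lambda>(g, x, h). g" "\<lambda>(g, x, h). x \<circ> h"])
  show "{e \<in> \<Omega>. \<not> independent4 a b c e}
    \<subseteq> {p \<in> \<Omega>. \<exists>t\<in>(stab a - {id}) \<times> stab c \<times> stab b.
          (case t of (g, x, h) \<Rightarrow> g) p = (case t of (g, x, h) \<Rightarrow> x \<circ> h) p}"
    unfolding independent4_def by force
qed (use assms stab_in comp_in in \<open>auto simp: independent3_def\<close>)

text \<open>The varying point \<open>b\<close> must not occur in the index set, so \<open>h\<close>
  is traded for \<open>m = inv g \<circ> (x \<circ> h)\<close>, which fixes \<open>e\<close>. Then
  \<open>g \<circ> m\<close> and \<open>x\<close> agree at \<open>b\<close>, and independence with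
  \<open>e\<close> in the middle keeps them distinct.\<close>

lemma card_dependent4_second:
  assumes "a \<in> \<Omega>" "c \<in> \<Omega>" "e \<in> \<Omega>" "independent3 a e c"
  shows "card {b \<in> \<Omega>. \<not> independent4 a b c e} \<le> exc"
proof (rule card_coincidences_stab3[of a e c "\<lambda>(g, m, x). g \<circ> m" "\<lambda>(g, m, x). x"])
  fix t assume "t \<in> (stab a - {id}) \<times> stab e \<times> stab c"
  then obtain g m x where t: "t = (g, m, x)" "g \<in> stab a - {id}" "m \<in> stab e" "x \<in> stab c" by auto
  have "g \<circ> m \<noteq> x"
  proof
    assume "g \<circ> m = x"
    then have "g = x \<circ> inv m" using inv_apply(2)[of m] t(3) stab_in by fastforce
    then show False using assms(4) t stab_inv unfolding independent3_def by blast
  qed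
  then show "(case t of (g, m, x) \<Rightarrow> g \<circ> m) \<in> G \<and> (case t of (g, m, x) \<Rightarrow> x) \<in> G
      \<and> (case t of (g, m, x) \<Rightarrow> g \<circ> m) \<noteq> (case t of (g, m, x) \<Rightarrow> x)"
    using t comp_in stab_in by auto
next
  show "{b \<in> \<Omega>. \<not> independent4 a b c e}
    \<subseteq> {p \<in> \<Omega>. \<exists>t\<in>(stab a - {id}) \<times> stab e \<times> stab c.
          (case t of (g, m, x) \<Rightarrow> g \<circ> m) p = (case t of (g, m, x) \<Rightarrow> x) p}"
  proof
    fix b assume "b \<in> {b \<in> \<Omega>. \<not> independent4 a b c e}"
    then obtain g x h where b: "b \<in> \<Omega>" "g \<in> stab a - {id}" "x \<in> stab c" "h \<in> stab b" "g e = x (h e)"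
      unfolding independent4_def by blast
    have G: "g \<in> G" "x \<in> G" "h \<in> G" using b stab_in by auto
    let ?m = "inv g \<circ> (x \<circ> h)"
    have "?m \<in> stab e"
      unfolding stab_def using G b(5) by (auto simp: comp_in inv_in inv_apply simp flip: b(5))
    moreover have "(g \<circ> ?m) b = x b"
      using G stab_fixes[OF b(4)] by (simp add: inv_apply)
    ultimately show "b \<in> {p \<in> \<Omega>. \<exists>t\<in>(stab a - {id}) \<times> stab e \<times> stab c.
          (case t of (g, m, x) \<Rightarrow> g \<circ> m) p = (case t of (g, m, x) \<Rightarrow> x) p}"
      using b by (intro CollectI conjI bexI[of _ "(g, ?m, x)"]) auto
  qed
qed (use assms in auto)

end

section \<open>Algebraic isomorphisms\<close>

lemma scheme_partition: "scheme \<Omega> S \<Longrightarrow> partition_of \<Omega> S"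
  by (simp add: scheme_def coherent_configuration_def)

lemma scheme_relation_subset: "scheme \<Omega> S \<Longrightarrow> s \<in> S \<Longrightarrow> s \<subseteq> \<Omega> \<times> \<Omega>"
  using scheme_partition[of \<Omega> S] unfolding partition_of_def by blast

lemma scheme_disjoint: "scheme \<Omega> S \<Longrightarrow> r \<in> S \<Longrightarrow> s \<in> S \<Longrightarrow> p \<in> r \<Longrightarrow> p \<in> s \<Longrightarrow> r = s"
  using scheme_partition[of \<Omega> S] unfolding partition_of_def by blast

lemma scheme_cover: "scheme \<Omega> S \<Longrightarrow> x \<in> \<Omega> \<Longrightarrow> y \<in> \<Omega> \<Longrightarrow> \<exists>s\<in>S. (x, y) \<in> s"
  using scheme_partition[of \<Omega> S] unfolding partition_of_def by blast

lemma scheme_nonempty: "scheme \<Omega> S \<Longrightarrow> s \<in> S \<Longrightarrow> s \<noteq> {}"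
  using scheme_partition[of \<Omega> S] unfolding partition_of_def by blast

lemma scheme_converse: "scheme \<Omega> S \<Longrightarrow> s \<in> S \<Longrightarrow> s\<inverse> \<in> S"
  by (simp add: scheme_def coherent_configuration_def)

lemma scheme_finite: "scheme \<Omega> S \<Longrightarrow> finite \<Omega>"
  by (simp add: scheme_def coherent_configuration_def)

lemma scheme_Id: "scheme \<Omega> S \<Longrightarrow> Id_on \<Omega> \<in> S"
  by (simp add: scheme_def)

lemma int_num_eq:
  assumes "scheme \<Omega> S" "r \<in> S" "s \<in> S" "t \<in> S" "(x, y) \<in> t"
  shows "int_num r s t = path_count r s x y"
proof -
  have "(SOME x. x \<in> t) \<in> t" using assms(5) by (rule someI)
  then show ?thesis
    using assms unfolding int_num_def Let_def scheme_def coherent_configuration_def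
    by (metis fst_conv snd_conv)
qed

lemma int_num_pos_iff:
  assumes "scheme \<Omega> S" "r \<in> S" "s \<in> S" "t \<in> S" "(x, y) \<in> t"
  shows "int_num r s t > 0 \<longleftrightarrow> (\<exists>z. (x, z) \<in> r \<and> (z, y) \<in> s)"
proof -
  have "{z. (x, z) \<in> r \<and> (z, y) \<in> s} \<subseteq> \<Omega>"
    using scheme_relation_subset[OF assms(1,2)] by auto
  then have "finite {z. (x, z) \<in> r \<and> (z, y) \<in> s}"
    using scheme_finite[OF assms(1)] finite_subset by blast
  then show ?thesis
    unfolding int_num_eq[OF assms] path_count_def by (auto simp: card_gt_0_iff)
qed

locale algebraic_iso =
  fixes \<Omega> :: "'a set" and S and \<Omega>' :: "'b set" and S' and \<phi>
  assumes S: "scheme \<Omega> S" and S': "scheme \<Omega>' S'" and iso: "algebraic_isomorphism S S' \<phi>"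
begin

lemma bij_rel: "bij_betw \<phi> S S'"
  using iso by (simp add: algebraic_isomorphism_def)

lemma image_in: "s \<in> S \<Longrightarrow> \<phi> s \<in> S'"
  using bij_rel bij_betwE by blast

lemma image_eq_iff: "r \<in> S \<Longrightarrow> s \<in> S \<Longrightarrow> \<phi> r = \<phi> s \<longleftrightarrow> r = s"
  using bij_rel by (metis bij_betw_def inj_on_eq_iff)

lemma image_cover: "x \<in> \<Omega>' \<Longrightarrow> y \<in> \<Omega>' \<Longrightarrow> \<exists>s\<in>S. (x, y) \<in> \<phi> s"
  using scheme_cover[OF S'] bij_rel by (metis bij_betw_def imageE)

lemma int_num_image: "r \<in> S \<Longrightarrow> s \<in> S \<Longrightarrow> t \<in> S \<Longrightarrow> int_num (\<phi> r) (\<phi> s) (\<phi> t) = int_num r s t"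
  using iso by (simp add: algebraic_isomorphism_def)

text \<open>A path through \<open>r\<close> and then \<open>s\<close> exists exactly when the
  intersection number is positive, and that number is preserved.\<close>

lemma path_transfer:
  assumes "r \<in> S" "s \<in> S" "t \<in> S" "(x, y) \<in> t" "(x', y') \<in> \<phi> t"
  shows "(\<exists>z. (x, z) \<in> r \<and> (z, y) \<in> s) \<longleftrightarrow> (\<exists>z. (x', z) \<in> \<phi> r \<and> (z, y') \<in> \<phi> s)"
  using int_num_pos_iff[OF S assms(1-4)] int_num_image[OF assms(1-3)]
    int_num_pos_iff[OF S' image_in[OF assms(1)] image_in[OF assms(2)] image_in[OF assms(3)] assms(5)]
  by simp

text \<open>Let \<open>e\<close> be the relation sent to the diagonal. The path made of
  \<open>e\<close> and a diagonal step transfers; its first step is then stationary, so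
  \<open>\<phi> (Id_on \<Omega>)\<close> meets \<open>\<phi> e\<close>.\<close>

lemma image_Id: "\<phi> (Id_on \<Omega>) = Id_on \<Omega>'"
proof -
  obtain e where e: "e \<in> S" "\<phi> e = Id_on \<Omega>'"
    using scheme_Id[OF S'] bij_rel by (metis bij_betw_def imageE)
  obtain p q where pq: "(p, q) \<in> e" using scheme_nonempty[OF S e(1)] by auto
  have p: "p \<in> \<Omega>" "q \<in> \<Omega>" using scheme_relation_subset[OF S e(1)] pq by auto
  obtain x' y' where x': "(x', y') \<in> \<phi> e" using scheme_nonempty[OF S' image_in[OF e(1)]] by auto
  have "\<exists>z. (p, z) \<in> e \<and> (z, q) \<in> Id_on \<Omega>" using pq p by auto
  then have "\<exists>z. (x', z) \<in> \<phi> e \<and> (z, y') \<in> \<phi> (Id_on \<Omega>)"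
    using path_transfer[OF e(1) scheme_Id[OF S] e(1) pq x'] by simp
  then have "(x', y') \<in> \<phi> (Id_on \<Omega>)" using e(2) by auto
  then show ?thesis using scheme_disjoint[OF S' image_in[OF scheme_Id[OF S]] image_in[OF e(1)]] x' e(2)
    by metis
qed

text \<open>A closed path along \<open>s\<close> and back transfers to a closed path at
  \<open>x'\<close>, whose second step lies both in \<open>\<phi> (s\<inverse>)\<close> and in the
  converse of \<open>\<phi> s\<close>.\<close>

lemma image_converse: assumes "s \<in> S" shows "\<phi> (s\<inverse>) = (\<phi> s)\<inverse>"
proof -
  have s': "s\<inverse> \<in> S" using scheme_converse[OF S assms] .
  obtain x y where xy: "(x, y) \<in> s" using scheme_nonempty[OF S assms] by auto
  have x: "(x, x) \<in> Id_on \<Omega>" using scheme_relation_subset[OF S assms] xy by auto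
  obtain x' y' where x'y': "(x', y') \<in> \<phi> s" using scheme_nonempty[OF S' image_in[OF assms]] by auto
  have x': "(x', x') \<in> \<phi> (Id_on \<Omega>)"
    unfolding image_Id using scheme_relation_subset[OF S' image_in[OF assms]] x'y' by auto
  have "\<exists>z. (x', z) \<in> \<phi> s \<and> (z, x') \<in> \<phi> (s\<inverse>)"
    using path_transfer[OF assms s' scheme_Id[OF S] x x'] xy by blast
  then obtain z where "(x', z) \<in> \<phi> s" "(z, x') \<in> \<phi> (s\<inverse>)" by blast
  then show ?thesis
    using scheme_disjoint[OF S' image_in[OF s'] scheme_converse[OF S' image_in[OF assms]]] by auto
qed

text \<open>The out-degree of \<open>s\<close> is the intersection number of \<open>s\<close> and
  \<open>s\<inverse>\<close> over the diagonal.\<close>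

lemma image_card_neighbours:
  assumes "s \<in> S" "x \<in> \<Omega>" "x' \<in> \<Omega>'"
  shows "card {y. (x', y) \<in> \<phi> s} = card {y. (x, y) \<in> s}"
proof -
  have s': "s\<inverse> \<in> S" using scheme_converse[OF S assms(1)] .
  have "int_num (\<phi> s) (\<phi> (s\<inverse>)) (\<phi> (Id_on \<Omega>)) = path_count (\<phi> s) (\<phi> (s\<inverse>)) x' x'"
    using assms s' scheme_Id[OF S'] image_in by (intro int_num_eq[OF S']) (auto simp: image_Id)
  moreover have "int_num s (s\<inverse>) (Id_on \<Omega>) = path_count s (s\<inverse>) x x"
    using assms s' scheme_Id[OF S] by (intro int_num_eq[OF S]) auto
  ultimately show ?thesis
    using int_num_image[OF assms(1) s' scheme_Id[OF S]]
    by (simp add: path_count_def image_converse[OF assms(1)])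
qed

text \<open>Injectivity holds because only the diagonal is sent to the diagonal. Surjectivity
  compares out-neighbourhoods, which have the same finite size on both sides. Disjointness of
  relations then upgrades inclusion to equality.\<close>

lemma isomorphism_of_pointwise:
  assumes f: "\<And>x y s. s \<in> S \<Longrightarrow> (x, y) \<in> s \<Longrightarrow> (f x, f y) \<in> \<phi> s"
  shows "isomorphism \<Omega> S \<Omega>' S' f" "induces f S \<phi>"
proof -
  have maps: "f x \<in> \<Omega>'" if "x \<in> \<Omega>" for x
    using f[OF scheme_Id[OF S], of x x] that by (auto simp: image_Id)
  have inj: "inj_on f \<Omega>"
  proof (rule inj_onI)
    fix x y assume xy: "x \<in> \<Omega>" "y \<in> \<Omega>" "f x = f y"
    obtain s where s: "s \<in> S" "(x, y) \<in> s" using scheme_cover[OF S xy(1,2)] by auto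
    have "(f x, f y) \<in> \<phi> (Id_on \<Omega>)" using maps xy by (auto simp: image_Id)
    then have "s = Id_on \<Omega>"
      using scheme_disjoint[OF S' _ _ f[OF s]] s(1) image_in scheme_Id[OF S] image_eq_iff by metis
    then show "x = y" using s(2) by auto
  qed
  have surj: "y' \<in> f ` \<Omega>" if x: "x \<in> \<Omega>" and y': "y' \<in> \<Omega>'" for x y'
  proof -
    obtain s where s: "s \<in> S" "(f x, y') \<in> \<phi> s" using image_cover[OF maps[OF x] y'] by auto
    let ?N = "{y. (x, y) \<in> s}" and ?N' = "{y. (f x, y) \<in> \<phi> s}"
    have N: "?N \<subseteq> \<Omega>" using scheme_relation_subset[OF S s(1)] by auto
    have N': "?N' \<subseteq> \<Omega>'" using scheme_relation_subset[OF S' image_in[OF s(1)]] by auto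
    have "f ` ?N = ?N'"
    proof (rule card_subset_eq)
      show "finite ?N'" using N' scheme_finite[OF S'] finite_subset by blast
      show "f ` ?N \<subseteq> ?N'" using f[OF s(1)] by auto
      show "card (f ` ?N) = card ?N'"
        using image_card_neighbours[OF s(1) x maps[OF x]] card_image[OF inj_on_subset[OF inj N]] by simp
    qed
    then show ?thesis using s(2) N by blast
  qed
  have bij: "bij_betw f \<Omega> \<Omega>'"
  proof -
    have "\<Omega> \<noteq> {}" using scheme_nonempty[OF S scheme_Id[OF S]] by auto
    then have "f ` \<Omega> = \<Omega>'" using maps surj by blast
    then show ?thesis using inj by (simp add: bij_betw_def)
  qed
  have img: "pair_image f s = \<phi> s" if s: "s \<in> S" for s
  proof
    show "pair_image f s \<subseteq> \<phi> s" using f[OF s] by (auto simp: pair_image_def)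
    show "\<phi> s \<subseteq> pair_image f s"
    proof
      fix p assume p: "p \<in> \<phi> s"
      then have "p \<in> \<Omega>' \<times> \<Omega>'" using scheme_relation_subset[OF S' image_in[OF s]] by auto
      then obtain x y where xy: "x \<in> \<Omega>" "y \<in> \<Omega>" "p = (f x, f y)"
        using bij by (auto simp: bij_betw_def)
      obtain t where t: "t \<in> S" "(x, y) \<in> t" using scheme_cover[OF S xy(1,2)] by auto
      have "t = s"
        using scheme_disjoint[OF S' _ _ f[OF t]] p xy(3) image_in s t(1) image_eq_iff by metis
      then show "p \<in> pair_image f s" using t xy(3) by (force simp: pair_image_def)
    qed
  qed
  show "induces f S \<phi>" using img by (simp add: induces_def)
  show "isomorphism \<Omega> S \<Omega>' S' f" using bij img image_in by (simp add: isomorphism_def)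
qed

end

section \<open>Frobenius schemes of large rank\<close>

text \<open>The rank enters only through this bound on the number of points. The most demanding
  choice below avoids sets of total size at most \<open>7 * exc\<close>.\<close>

locale large_frobenius = frobenius_valency \<Omega> G k + algebraic_iso \<Omega> "orbits2 \<Omega> G" \<Omega>' S' \<phi>
  for \<Omega> :: "'a set" and G k and \<Omega>' :: "'b set" and S' \<phi> +
  assumes large: "card \<Omega> > 12 * exc"
begin

section \<open>Matching pairs and rigidity\<close>

definition matches :: "'a \<Rightarrow> 'a \<Rightarrow> 'b \<Rightarrow> 'b \<Rightarrow> bool" where
  "matches x y x' y' \<longleftrightarrow> (x', y') \<in> \<phi> (orbital x y)"

lemma orbital_converse: "(orbital x y)\<inverse> = orbital y x"
  by (auto simp: orbital_def)

lemma matches_sym: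
  "x \<in> \<Omega> \<Longrightarrow> y \<in> \<Omega> \<Longrightarrow> matches x y x' y' \<Longrightarrow> matches y x y' x'"
  using image_converse[OF orbital_in, of x y] orbital_converse by (simp add: matches_def)

lemma matches_points:
  "x \<in> \<Omega> \<Longrightarrow> y \<in> \<Omega> \<Longrightarrow> matches x y x' y' \<Longrightarrow> x' \<in> \<Omega>' \<and> y' \<in> \<Omega>'"
  using scheme_relation_subset[OF S' image_in[OF orbital_in, of x y]] by (auto simp: matches_def)

lemma matches_refl: assumes "x \<in> \<Omega>" "x' \<in> \<Omega>'" shows "matches x x x' x'"
proof -
  have "orbital x x = Id_on \<Omega>"
    using orbits2_eq_orbital[OF scheme_Id[OF S], of x x] assms by auto
  then show ?thesis using assms by (auto simp: matches_def image_Id)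
qed

text \<open>The path from \<open>a\<close> over \<open>e\<close> to \<open>b\<close> transfers along
  the matching pair. The case \<open>a = b\<close> starts the construction in
  \<open>induced\<close>.\<close>

lemma matches_extend:
  assumes "a \<in> \<Omega>" "b \<in> \<Omega>" "e \<in> \<Omega>" "matches a b a' b'"
  obtains e' where "e' \<in> \<Omega>'" "matches a e a' e'" "matches b e b' e'"
proof -
  have "\<exists>z. (a, z) \<in> orbital a e \<and> (z, b) \<in> orbital e b" using orbital_refl by blast
  then have "\<exists>z. (a', z) \<in> \<phi> (orbital a e) \<and> (z, b') \<in> \<phi> (orbital e b)"
    using path_transfer[OF orbital_in orbital_in orbital_in orbital_refl, of a e e b a b a' b'] assms
    by (simp add: matches_def)
  then obtain e' where e': "matches a e a' e'" "matches e b e' b'" by (auto simp: matches_def)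
  show ?thesis
    using that[of e'] e' matches_sym[OF assms(3,2)] matches_points[OF assms(1,3)] by blast
qed

text \<open>The path \<open>c'\<close>, \<open>a'\<close>, \<open>e'\<close> pulls back, so
  \<open>t\<close> lies in the complex product of \<open>orbital c a\<close> and
  \<open>orbital a e\<close>. The relations in this product are reached from \<open>c\<close> by
  moving \<open>e\<close> under \<open>stab a\<close>.\<close>

lemma relation_via_base_point:
  assumes pts: "a \<in> \<Omega>" "c \<in> \<Omega>" "e \<in> \<Omega>" and t: "t \<in> orbits2 \<Omega> G" "(c', e') \<in> \<phi> t"
    and m: "matches a c a' c'" "matches a e a' e'"
  obtains g where "g \<in> stab a" "t = orbital c (g e)"
proof -
  obtain c1 e1 where ce: "(c1, e1) \<in> t" using scheme_nonempty[OF S t(1)] by auto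
  have "\<exists>z. (c', z) \<in> \<phi> (orbital c a) \<and> (z, e') \<in> \<phi> (orbital a e)"
    using m matches_sym[OF pts(1,2)] by (auto simp: matches_def)
  then obtain z where z: "(c1, z) \<in> orbital c a" "(z, e1) \<in> orbital a e"
    using path_transfer[OF orbital_in orbital_in t(1) ce t(2), of c a a e] pts by auto
  \<comment> \<open>Translating back by \<open>p\<close> moves the start of the path to
    \<open>c\<close> and its middle point to \<open>a\<close>.\<close>
  obtain p where p: "p \<in> G" "c1 = p c" "z = p a" using z(1) by (auto simp: orbital_def)
  have "(a, inv p e1) \<in> orbital a e"
  proof -
    have "orbital a (inv p e1) = orbital z e1"
      using orbital_image[OF p(1), of a "inv p e1"] p by (simp add: inv_apply)
    also have "\<dots> = orbital a e" using orbital_eq[OF z(2)] .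
    finally show ?thesis using orbital_refl by metis
  qed
  then obtain g where g: "g \<in> stab a" "inv p e1 = g e" using orbital_stab by metis
  have "t = orbital c1 e1" using orbits2_eq_orbital[OF t(1) ce] .
  also have "\<dots> = orbital c (inv p e1)"
    using orbital_image[OF p(1), of c "inv p e1"] p by (simp add: inv_apply)
  finally show ?thesis using that g by simp
qed

text \<open>The relation \<open>t\<close> pulled back from \<open>(c', e')\<close> lies in the
  complex products through \<open>a\<close> and through \<open>b\<close>. Comparing the two
  descriptions up to \<open>stab c\<close>, independence leaves only
  \<open>orbital c e\<close>.\<close>

lemma matches_rigid:
  assumes pts: "a \<in> \<Omega>" "b \<in> \<Omega>" "c \<in> \<Omega>" "e \<in> \<Omega>" and ind: "independent4 a b c e"
    and m: "matches a c a' c'" "matches a e a' e'" "matches b c b' c'" "matches b e b' e'"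
  shows "matches c e c' e'"
proof -
  have "c' \<in> \<Omega>'" "e' \<in> \<Omega>'" using matches_points m pts by metis+
  then obtain t where t: "t \<in> orbits2 \<Omega> G" "(c', e') \<in> \<phi> t" using image_cover by metis
  obtain g where g: "g \<in> stab a" "t = orbital c (g e)"
    using relation_via_base_point[OF pts(1,3,4) t m(1,2)] .
  obtain h where h: "h \<in> stab b" "t = orbital c (h e)"
    using relation_via_base_point[OF pts(2,3,4) t m(3,4)] .
  obtain x where "x \<in> stab c" "g e = x (h e)" using orbital_same_source g(2) h(2) by metis
  then have "g = id" using ind g(1) h(1) unfolding independent4_def by blast
  then show ?thesis using g(2) t(2) by (simp add: matches_def)
qed

lemma avoid:
  assumes "sum_list (map card Xs) \<le> 12 * exc" and "\<forall>X\<in>set Xs. finite X"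
  shows "\<exists>p\<in>\<Omega>. \<forall>X\<in>set Xs. p \<notin> X"
proof (rule ccontr)
  assume "\<not> ?thesis"
  then have "\<Omega> \<subseteq> \<Union>(set Xs)" by blast
  then have "card \<Omega> \<le> card (\<Union>(set Xs))" using assms(2) by (intro card_mono) auto
  also have "\<dots> \<le> sum_list (map card Xs)"
  proof (induction Xs)
    case (Cons X Xs)
    then show ?case using card_Un_le[of X "\<Union>(set Xs)"] by auto
  qed simp
  finally show False using large assms(1) by linarith
qed

section \<open>Construction of the inducing bijection\<close>

theorem induced: "\<exists>f. isomorphism \<Omega> (orbits2 \<Omega> G) \<Omega>' S' f \<and> induces f (orbits2 \<Omega> G) \<phi>"
proof -
  obtain \<alpha> where \<alpha>: "\<alpha> \<in> \<Omega>" using avoid[of "[]"] by auto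
  obtain \<beta> where \<beta>: "\<beta> \<in> \<Omega>" "\<beta> \<noteq> \<alpha>" using avoid[of "[{\<alpha>}]"] exc_ge_1 by auto
  obtain \<alpha>' where \<alpha>': "\<alpha>' \<in> \<Omega>'" using scheme_nonempty[OF S' scheme_Id[OF S']] by auto
  obtain \<beta>' where \<beta>': "matches \<alpha> \<beta> \<alpha>' \<beta>'"
    using matches_extend[OF \<alpha> \<alpha> \<beta>(1) matches_refl[OF \<alpha> \<alpha>']] .
  \<comment> \<open>The first lift \<open>f0\<close> ties each point only to the frame \<alpha>,
    \<beta>.\<close>
  have "\<exists>e'. matches \<alpha> e \<alpha>' e' \<and> matches \<beta> e \<beta>' e'" if "e \<in> \<Omega>" for e
    using matches_extend[OF \<alpha> \<beta>(1) that \<beta>'] by metis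
  then obtain f0 where f0: "\<And>e. e \<in> \<Omega> \<Longrightarrow> matches \<alpha> e \<alpha>' (f0 e)"
    "\<And>e. e \<in> \<Omega> \<Longrightarrow> matches \<beta> e \<beta>' (f0 e)" by metis
  \<comment> \<open>Points of \<open>X\<close> are in special position to the frame, so rigidity
    does not control their values under \<open>f0\<close>.\<close>
  define X where "X = {c \<in> \<Omega>. \<not> independent3 \<alpha> \<beta> c}"
  define bad where "bad c c' = {e \<in> \<Omega>. \<not> matches c e c' (f0 e)}" for c c'
  have fin: "finite (bad c c')" for c c' using finite_points by (simp add: bad_def)
  have finX: "finite X" using finite_points by (simp add: X_def)
  have cX: "card X \<le> exc" unfolding X_def using card_dependent3_third \<alpha> \<beta> by metis
  have bad_f0: "card (bad c (f0 c)) \<le> exc" if c: "c \<in> \<Omega>" "c \<notin> X" for c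
  proof -
    have "bad c (f0 c) \<subseteq> {e \<in> \<Omega>. \<not> independent4 \<alpha> \<beta> c e}"
      using matches_rigid[OF \<alpha> \<beta>(1) c(1) _ _ f0(1) f0(1) f0(2) f0(2)] c(1)
      unfolding bad_def by auto
    then have "card (bad c (f0 c)) \<le> card {e \<in> \<Omega>. \<not> independent4 \<alpha> \<beta> c e}"
      using finite_points by (intro card_mono) auto
    also have "\<dots> \<le> exc" using card_dependent4_fourth \<alpha> \<beta>(1) c by (simp add: X_def)
    finally show ?thesis .
  qed
  have "\<exists>c'. c' \<in> \<Omega>' \<and> card (bad c c') \<le> 3 * exc" if c: "c \<in> \<Omega>" for c
  proof -
    \<comment> \<open>To correct the lift of \<open>c\<close>, the frame is replaced by points
      \<open>a\<close>, \<open>b\<close> outside \<open>X\<close> whose lifts match each other and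
      which are independent with \<open>c\<close>.\<close>
    have "sum_list (map card [X, {c}]) \<le> 12 * exc" using cX exc_ge_1 by simp
    from avoid[OF this] obtain a where a: "a \<in> \<Omega>" "a \<notin> X" "a \<noteq> c"
      using finX by auto
    let ?D = "{b \<in> \<Omega>. \<not> independent3 a b c}"
    have "card ?D \<le> exc" using card_dependent3_second a c by metis
    then have "sum_list (map card [X, bad a (f0 a), ?D]) \<le> 12 * exc"
      using cX bad_f0[OF a(1,2)] by simp
    from avoid[OF this] obtain b where b: "b \<in> \<Omega>" "b \<notin> X" "b \<notin> bad a (f0 a)" "b \<notin> ?D"
      using finX fin finite_points by auto
    have ab: "matches a b (f0 a) (f0 b)" using b by (simp add: bad_def)
    obtain c' where c': "c' \<in> \<Omega>'" "matches a c (f0 a) c'" "matches b c (f0 b) c'"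
      using matches_extend[OF a(1) b(1) c ab] .
    let ?E = "{e \<in> \<Omega>. \<not> independent4 a b c e}"
    have "card ?E \<le> exc" using card_dependent4_fourth a(1) b(1,4) c by simp
    \<comment> \<open>A point fails to match \<open>c\<close> only if it is dependent on
      \<open>a\<close>, \<open>b\<close>, \<open>c\<close> or fails to match \<open>a\<close> or
      \<open>b\<close>. Each cause contributes at most \<open>exc\<close>.\<close>
    moreover have "bad c c' \<subseteq> ?E \<union> (bad a (f0 a) \<union> bad b (f0 b))"
      using matches_rigid[OF a(1) b(1) c _ _ c'(2) _ c'(3)] unfolding bad_def by auto
    then have "card (bad c c') \<le> card (?E \<union> (bad a (f0 a) \<union> bad b (f0 b)))"
      using finite_points fin by (intro card_mono) auto
    moreover have "\<dots> \<le> card ?E + (card (bad a (f0 a)) + card (bad b (f0 b)))"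
      using card_Un_le[of ?E] card_Un_le[of "bad a (f0 a)"] by (meson add_left_mono order_trans)
    ultimately have "card (bad c c') \<le> 3 * exc" using bad_f0[OF a(1,2)] bad_f0[OF b(1,2)] by linarith
    then show ?thesis using c'(1) by blast
  qed
  then obtain f where f: "\<And>c. c \<in> \<Omega> \<Longrightarrow> f c \<in> \<Omega>'" "\<And>c. c \<in> \<Omega> \<Longrightarrow> card (bad c (f c)) \<le> 3 * exc"
    by metis
  have match: "matches c e (f c) (f e)" if c: "c \<in> \<Omega>" and e: "e \<in> \<Omega>" for c e
  proof -
    \<comment> \<open>Here \<open>e\<close> stands in the middle because
      \<open>card_dependent4_second\<close> needs this order when \<open>b\<close> is chosen after
      \<open>a\<close>.\<close>
    let ?A = "{a \<in> \<Omega>. \<not> independent3 a e c}"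
    have "card ?A \<le> exc" using card_dependent3_first e c by simp
    then have "sum_list (map card [bad c (f c), bad e (f e), ?A]) \<le> 12 * exc"
      using f(2)[OF c] f(2)[OF e] by simp
    from avoid[OF this]
    obtain a where a: "a \<in> \<Omega>" "a \<notin> bad c (f c)" "a \<notin> bad e (f e)" "a \<notin> ?A"
      using fin finite_points by auto
    let ?B = "{b \<in> \<Omega>. \<not> independent4 a b c e}"
    have "card ?B \<le> exc" using card_dependent4_second a(1,4) c e by simp
    then have "sum_list (map card [bad c (f c), bad e (f e), ?B]) \<le> 12 * exc"
      using f(2)[OF c] f(2)[OF e] by simp
    from avoid[OF this] obtain b where b: "b \<in> \<Omega>" "b \<notin> bad c (f c)" "b \<notin> bad e (f e)" "b \<notin> ?B"
      using fin finite_points by auto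
    \<comment> \<open>The lifts \<open>f0 a\<close> and \<open>f0 b\<close> serve as base points:
      both match \<open>f c\<close> and \<open>f e\<close>, while no match between them is asked
      for.\<close>
    show ?thesis
      using a b c e matches_sym
      by (intro matches_rigid[OF a(1) b(1) c e, of "f0 a" _ _ "f0 b"]) (auto simp: bad_def)
  qed
  have "(f x, f y) \<in> \<phi> s" if "s \<in> orbits2 \<Omega> G" "(x, y) \<in> s" for x y s
    using match[of x y] orbits2_eq_orbital[OF that] scheme_relation_subset[OF S that(1)] that(2)
    by (auto simp: matches_def)
  then show ?thesis using isomorphism_of_pointwise by blast
qed

end

section \<open>From the rank to the number of points\<close>

lemma card_points_eq:
  assumes "scheme \<Omega> S" "scheme_valency_is \<Omega> S k"
  shows "card \<Omega> = 1 + (card S - 1) * k"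
proof -
  obtain a where a: "a \<in> \<Omega>" using scheme_nonempty[OF assms(1) scheme_Id[OF assms(1)]] by auto
  have fin: "finite \<Omega>" using scheme_finite[OF assms(1)] .
  have "S \<subseteq> Pow (\<Omega> \<times> \<Omega>)" using scheme_relation_subset[OF assms(1)] by auto
  then have finS: "finite S" using fin finite_subset by blast
  let ?N = "\<lambda>s. {b. (a, b) \<in> s}"
  have N: "?N s \<subseteq> \<Omega>" if "s \<in> S" for s using scheme_relation_subset[OF assms(1) that] by auto
  \<comment> \<open>The out-neighbourhoods of the fixed point \<open>a\<close> partition \<Omega>;
    the diagonal contributes one point and every other relation \<open>k\<close>.\<close>
  have "\<Omega> = (\<Union>s\<in>S. ?N s)" using N scheme_cover[OF assms(1) a] by auto
  then have "card \<Omega> = card (\<Union>s\<in>S. ?N s)" by simp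
  also have "\<dots> = (\<Sum>s\<in>S. card (?N s))"
    using finS N finite_subset[OF N fin] scheme_disjoint[OF assms(1)]
    by (intro card_UN_disjoint) blast+
  also have "\<dots> = card (?N (Id_on \<Omega>)) + (\<Sum>s\<in>S - {Id_on \<Omega>}. card (?N s))"
    using finS scheme_Id[OF assms(1)] by (rule sum.remove)
  also have "?N (Id_on \<Omega>) = {a}" using a by auto
  also have "(\<Sum>s\<in>S - {Id_on \<Omega>}. card (?N s)) = (\<Sum>s\<in>S - {Id_on \<Omega>}. k)"
    using assms(2) a by (intro sum.cong) (auto simp: scheme_valency_is_def valency_def)
  finally show ?thesis using finS scheme_Id[OF assms(1)] by simp
qed

lemma rank_bound_arith:
  fixes k n r :: nat
  assumes "k \<ge> 2" "r \<ge> 4 * (k - 1) * k ^ 3" "n = 1 + (r - 1) * k"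
  shows "n > 12 * ((k - 1) * k ^ 2)"
proof -
  have "k ^ 3 = k * k ^ 2" by (simp add: power3_eq_cube power2_eq_square)
  then have "2 * k ^ 2 \<le> k ^ 3" using assms(1) by simp
  then have "4 * (k - 1) * (2 * k ^ 2) \<le> 4 * (k - 1) * k ^ 3" by (rule mult_left_mono) simp
  then have "8 * ((k - 1) * k ^ 2) \<le> r" using assms(2) by (simp add: algebra_simps)
  moreover have "(k - 1) * k ^ 2 \<ge> 1" using assms(1) by (simp add: Suc_le_eq)
  \<comment> \<open>Lowering the factor from 8 to 6 absorbs the subtracted 1; the factor
    \<open>k \<ge> 2\<close> then doubles 6 to 12.\<close>
  ultimately have "6 * ((k - 1) * k ^ 2) \<le> r - 1" by linarith
  then have "6 * ((k - 1) * k ^ 2) * 2 \<le> (r - 1) * k" using assms(1) by (rule mult_le_mono)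
  then show ?thesis using assms(3) by linarith
qed

lemma frobenius_valency_of_scheme:
  assumes "frobenius_group \<Omega> G" "scheme_valency_is \<Omega> (orbits2 \<Omega> G) k"
  shows "frobenius_valency \<Omega> G k"
proof -
  interpret frobenius \<Omega> G using assms(1) by unfold_locales
  obtain g x where g: "g \<in> G" "x \<in> \<Omega>" "g x = x" "g \<noteq> id"
    using assms(1) unfolding frobenius_group_def regular_on_def by blast
  \<comment> \<open>Elements of \<open>G\<close> are trivial outside \<Omega>, so \<open>g\<close>
    moves some point of \<Omega>. This second point provides the non-diagonal relations from which
    \<open>k\<close> is read off.\<close>
  obtain y where y: "y \<in> \<Omega>" "y \<noteq> x"
    using g fixes_outside by (metis ext id_apply)
  have card: "card (stab a) = k" if a: "a \<in> \<Omega>" for a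
  proof -
    obtain b where b: "b \<in> \<Omega>" "a \<noteq> b" using y g(2) by metis
    have "(a, b) \<in> orbital a b" "(a, b) \<notin> Id_on \<Omega>" using orbital_refl b(2) by auto
    then show ?thesis
      using valency_orbital[OF a b] assms(2) orbital_in[OF a b(1)] a
      unfolding scheme_valency_is_def by metis
  qed
  have "{g, id} \<subseteq> stab x" using g id_in by (auto simp: stab_def)
  then have "card {g, id} \<le> card (stab x)"
    using finite_stab[OF g(2) y(1)] y(2) by (intro card_mono) auto
  then have "k \<ge> 2" using g card[OF g(2)] by simp
  then show ?thesis using card by unfold_locales auto
qed

theorem theorem1p2:
  fixes \<Omega> :: "'a set" and S :: "('a \<times> 'a) set set" and k :: nat
  assumes "scheme \<Omega> S"
    and "frobenius_scheme \<Omega> S"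
    and "scheme_valency_is \<Omega> S k"
    and "card S \<ge> 4 * (k - 1) * k ^ 3"
  shows "(\<forall>(\<Omega>' :: 'b set) S' \<phi>. scheme \<Omega>' S' \<and> algebraic_isomorphism S S' \<phi> \<longrightarrow>
            (\<exists>f. isomorphism \<Omega> S \<Omega>' S' f)) \<and>
         (\<forall>(\<Omega>' :: 'b set) S' \<phi>. scheme \<Omega>' S' \<and> algebraic_isomorphism S S' \<phi> \<longrightarrow>
            (\<exists>f. isomorphism \<Omega> S \<Omega>' S' f \<and> induces f S \<phi>))"
proof -
  obtain G where G: "frobenius_group \<Omega> G" "S = orbits2 \<Omega> G"
    using assms(2) unfolding frobenius_scheme_def by blast
  interpret frobenius_valency \<Omega> G k
    using frobenius_valency_of_scheme[OF G(1)] assms(3) G(2) by simp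
  have "card \<Omega> > 12 * exc"
    unfolding exc_def by (rule rank_bound_arith[OF k_ge_2 assms(4) card_points_eq[OF assms(1,3)]])
  then have "\<exists>f. isomorphism \<Omega> S \<Omega>' S' f \<and> induces f S \<phi>"
    if "scheme \<Omega>' S'" "algebraic_isomorphism S S' \<phi>" for \<Omega>' :: "'b set" and S' \<phi>
  proof -
    interpret large_frobenius \<Omega> G k \<Omega>' S' \<phi>
      using assms(1) that G(2) \<open>card \<Omega> > 12 * exc\<close> by unfold_locales simp_all
    show ?thesis using induced G(2) by simp
  qed
  then show ?thesis by blast
qed

end
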